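(* Let $f:\mathbb R^d\to\mathbb R$ be differentiable and let $\mathbf L=(L_1,\dots,L_d)$ be a nonnegative vector such that for all $\mathbf x,\mathbf y\in\mathbb R^d$, $f(\mathbf y)\le f(\mathbf x)+\langle\nabla f(\mathbf x),\mathbf y-\mathbf x\rangle+\frac12\sum_{i=1}^dL_i(y_i-x_i)^2$. Let $Q$ be the symmetric uniform quantizer with scales $s_1,\dots,s_d>0$ (see context). Let $\mathbf x$ be a random shadow weight with endpoint $\mathbf q=Q(\mathbf x)$, let $\mathbf g=\nabla f(\mathbf q)$, let $\mathbf u=\mathcal U(\mathbf g)$ for an update map $\mathcal U:\mathbb R^d\to\mathbb R^d$, and suppose $\|\mathbf u\|_\infty\le U<\infty$. Let $\eta>0$ be a stepsize with $\eta U<s_i$ for every $i$. Put $\mathbf x^+=\mathbf x-\eta\mathbf u$, $\mathbf q^+=Q(\mathbf x^+)$, $J_i=\mathbf 1\{q_i^+\ne q_i\}$, $\mathbf J=(J_1,\dots,J_d)$, and let $$p_i=p_i(\eta,\mathbf q,\mathbf u)=\Pr(J_i=1\mid\eta,\mathbf q,\mathbf u)=\mathbb E[J_i\mid\eta,\mathbf q,\mathbf u].$$ Then the endpoint update can be written as $$\mathbf q^+-\mathbf q=-\mathbf s\odot\operatorname{sign}(\mathbf u)\odot\mathbf J,$$ where $J_i\in\{0,1\}$ satisfies $\Pr(J_i=1\mid\eta,\mathbf q,\mathbf u)=p_i$, and consequently $$\mathbb E[f(\mathbf q^+)-f(\mathbf q)\mid\eta,\mathbf q,\mathbf u]\le-\sum_ip_is_i\operatorname{sign}(u_i)g_i+\frac12\sum_ip_iL_is_i^2.$$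 If, in addition, $\mathbf q$ is non-saturated in each coordinate and $p_i(\eta,\mathbf q,\mathbf u)=\eta|u_i|/s_i$ for each (non-saturated) coordinate $i$, then $$\mathbb E[f(\mathbf q^+)-f(\mathbf q)\mid\eta,\mathbf q,\mathbf u]\le-\eta\langle\mathbf g,\mathbf u\rangle+\frac\eta2\sum_iL_is_i|u_i|.$$
   Context: Quantizer: for a bit width $b$, let $K_b=2^{b-1}-1$ and $Q(\mathbf x)_i=s_i\,\mathrm{clamp}(\lfloor x_i/s_i\rceil;-K_b,K_b)$, where $\lfloor\cdot\rceil$ is rounding to the nearest integer (interior cells are half-open, $[s_i(k-\frac12),s_i(k+\frac12))$) and $\mathrm{clamp}(a;\ell,u)=\min\{\max\{a,\ell\},u\}$. Coordinate $i$ of $\mathbf q=Q(\mathbf x)$ is non-saturated if its code $k_i=q_i/s_i$ satisfies $-K_b<k_i<K_b$. The symbol $\odot$ is the coordinatewise product, $\operatorname{sign}$ acts coordinatewise with $\operatorname{sign}(0)=0$. All probabilities and expectations are conditional on the current endpoint $\mathbf q$, the update direction $\mathbf u$ and the stepsize $\eta$; the randomness is that of $\mathbf x$ inside its quantization cell. The crossing indicators $J_i$ are Bernoulli with conditional means $p_i$; no independence across coordinates is assumed. *)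

theory Defs
  imports "HOL-Analysis.Analysis" "HOL-Probability.Probability"
begin

definition gradient :: "('a::real_inner \<Rightarrow> real) \<Rightarrow> 'a \<Rightarrow> 'a" where
  "gradient f x = (THE D. GDERIV f x :> D)"

lemma GDERIV_gradient:
  fixes f :: "'a::euclidean_space \<Rightarrow> real"
  assumes "f differentiable (at x)"
  shows "GDERIV f x :> gradient f x"
proof -
  obtain f' where f': "(f has_derivative f') (at x)"
    using assms by (auto simp: differentiable_def)
  interpret f': bounded_linear f' using f' by (rule has_derivative_bounded_linear)
  define D where "D = (\<Sum>b\<in>Basis. f' b *\<^sub>R b)"
  have "f' h = h \<bullet> D" for h
  proof -
    have "f' h = f' (\<Sum>b\<in>Basis. (h \<bullet> b) *\<^sub>R b)" by (simp add: euclidean_representation)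
    also have "\<dots> = (\<Sum>b\<in>Basis. (h \<bullet> b) * f' b)" by (simp add: f'.sum f'.scaleR)
    also have "\<dots> = h \<bullet> D" by (simp add: D_def inner_sum_right mult.commute)
    finally show ?thesis .
  qed
  then have "f' = (\<lambda>h. h \<bullet> D)" by (rule ext)
  with f' have D: "GDERIV f x :> D" by (simp add: gderiv_def)
  have "D' = D" if "GDERIV f x :> D'" for D'
  proof -
    have "(\<lambda>h. h \<bullet> D') = (\<lambda>h. h \<bullet> D)"
      using that D unfolding gderiv_def by (rule has_derivative_unique)
    then have "h \<bullet> D' = h \<bullet> D" for h by (rule fun_cong)
    then show ?thesis by (metis vector_eq_ldot)
  qed
  with D show ?thesis unfolding gradient_def by (rule theI)
qed

definition K :: "nat \<Rightarrow> int" where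
  "K b = 2 ^ (b - 1) - 1"

text \<open>The name avoids \<open>clamp\<close>, which in \<open>HOL-Analysis\<close> is a different function on Euclidean spaces.\<close>

definition clip :: "int \<Rightarrow> int \<Rightarrow> int \<Rightarrow> int" where
  "clip a l h = min (max a l) h"

text \<open>\<open>round x\<close> is the floor of \<open>x + 1/2\<close>, so that ties are rounded up and the interior cells of
  the quantizer are the half-open intervals from \<open>s $ i * (k - 1/2)\<close> (included)
  to \<open>s $ i * (k + 1/2)\<close> (excluded).\<close>

definition quantize :: "nat \<Rightarrow> real ^ 'd \<Rightarrow> real ^ 'd \<Rightarrow> real ^ 'd" where
  "quantize b s x = (\<chi> i. s $ i * of_int (clip (round (x $ i / s $ i)) (- K b) (K b)))"

definition nonsaturated :: "nat \<Rightarrow> real ^ 'd \<Rightarrow> real ^ 'd \<Rightarrow> 'd \<Rightarrow> bool" where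
  "nonsaturated b s q i \<longleftrightarrow> - of_int (K b) < q $ i / s $ i \<and> q $ i / s $ i < of_int (K b)"

text \<open>The library's \<open>sgn\<close> on \<open>real ^ 'd\<close> is normalization to unit length, hence this separate
  coordinatewise sign. Multiplication \<open>*\<close> on \<open>real ^ 'd\<close> is already coordinatewise.\<close>

definition vsign :: "real ^ 'd \<Rightarrow> real ^ 'd" where
  "vsign u = (\<chi> i. sgn (u $ i))"

text \<open>Conditional expectation of \<open>Z\<close> and conditional probability of the event \<open>P\<close>, given the
  random variable \<open>Y\<close>, that is, given the sigma-algebra generated by \<open>Y\<close>. As usual they
  are determined only up to null sets.\<close>

definition cond_expectation ::
    "'w measure \<Rightarrow> ('w \<Rightarrow> 'b::topological_space) \<Rightarrow> ('w \<Rightarrow> real) \<Rightarrow> 'w \<Rightarrow> real" where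
  "cond_expectation M Y Z = real_cond_exp M (vimage_algebra (space M) Y borel) Z"

definition cond_probability ::
    "'w measure \<Rightarrow> ('w \<Rightarrow> 'b::topological_space) \<Rightarrow> ('w \<Rightarrow> bool) \<Rightarrow> 'w \<Rightarrow> real" where
  "cond_probability M Y P = cond_expectation M Y (indicator {\<omega> \<in> space M. P \<omega>})"

end

theory Submission
  imports Defs
begin

text \<open>A step shorter than the scale moves each code by at most one, in the direction opposite to
  the sign of the update. Substituting \<open>q' - q\<close> into the smoothness inequality bounds
  \<open>f q' - f q\<close> by a sum of crossing indicators whose coefficients depend on \<open>q\<close> and \<open>u\<close>
  only; conditioning replaces each indicator by its probability. Integrability and measurability
  come for free because \<open>q\<close> and \<open>q'\<close> take finitely many values, so that everything computed
  from them is a simple function, however irregular the update map.\<close>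

lemma clip_in_range: "l \<le> h \<Longrightarrow> clip a l h \<in> {l..h}"
  by (auto simp: clip_def)

lemma K_nonneg: "0 \<le> K b"
  by (simp add: K_def)

text \<open>In \<open>quantize_step\<close> this is used with \<open>y = x $ i / s $ i\<close> and
  \<open>t = v $ i / s $ i\<close>. The floor behind \<open>round\<close> moves by at most one,
  against the sign of \<open>t\<close>; clipping is monotone and 1-Lipschitz on the integers, so
  both facts survive saturation. At \<open>t = 0\<close> the codes agree and both sides
  vanish.\<close>

lemma clip_round_step:
  fixes y t :: real
  assumes "\<bar>t\<bar> < 1"
  shows "real_of_int (clip (round (y - t)) l h) - of_int (clip (round y) l h)
    = - sgn t * (if clip (round (y - t)) l h \<noteq> clip (round y) l h then 1 else 0)"
proof (cases "t \<ge> 0")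
  case True
  have "round (y - t) \<le> round y"
    using True by (intro round_mono) simp
  moreover have "round y - 1 \<le> round (y - t)"
    using assms True unfolding round_def by linarith
  ultimately have "clip (round (y - t)) l h = clip (round y) l h
      \<or> clip (round (y - t)) l h = clip (round y) l h - 1"
    unfolding clip_def by linarith
  with True show ?thesis by (cases "t = 0") auto
next
  case False
  have "round y \<le> round (y - t)"
    using False by (intro round_mono) simp
  moreover have "round (y - t) \<le> round y + 1"
    using assms False unfolding round_def by linarith
  ultimately have "clip (round (y - t)) l h = clip (round y) l h
      \<or> clip (round (y - t)) l h = clip (round y) l h + 1"
    unfolding clip_def by linarith
  with False show ?thesis by auto
qed

lemma quantize_step:
  fixes s x v :: "real ^ 'd"
  assumes s: "0 < s $ i" and v: "\<bar>v $ i\<bar> < s $ i"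
  shows "quantize b s (x - v) $ i - quantize b s x $ i
    = - (s $ i * sgn (v $ i) * (if quantize b s (x - v) $ i \<noteq> quantize b s x $ i then 1 else 0))"
proof -
  have t: "\<bar>v $ i / s $ i\<bar> < 1"
    using s v by simp
  have "quantize b s (x - v) $ i - quantize b s x $ i
      = s $ i * (of_int (clip (round (x $ i / s $ i - v $ i / s $ i)) (- K b) (K b))
          - of_int (clip (round (x $ i / s $ i)) (- K b) (K b)))"
    by (simp add: quantize_def diff_divide_distrib right_diff_distrib)
  also have "\<dots> = s $ i * (- sgn (v $ i / s $ i)
      * (if quantize b s (x - v) $ i \<noteq> quantize b s x $ i then 1 else 0))"
    \<comment> \<open>Since \<open>s $ i\<close> is nonzero, two codes differ exactly when the
      quantized coordinates do.\<close>
    unfolding clip_round_step[OF t] using s by (simp add: quantize_def diff_divide_distrib)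
  also have "sgn (v $ i / s $ i) = sgn (v $ i)"
    using s by (simp add: sgn_divide)
  finally show ?thesis
    by simp
qed

lemma finite_range_quantize: "finite (range (quantize b s))"
proof (rule finite_subset)
  \<comment> \<open>Over \<open>UNIV\<close> every function is extensional, so the function space on
    the right contains all code vectors with entries in \<open>{- K b..K b}\<close>.\<close>
  show "range (quantize b s)
      \<subseteq> (\<lambda>c. \<chi> i. s $ i * of_int (c i)) ` (UNIV \<rightarrow>\<^sub>E {- K b..K b})"
  proof safe
    fix x
    have "clip (round (x $ i / s $ i)) (- K b) (K b) \<in> {- K b..K b}" for i
      using K_nonneg[of b] by (intro clip_in_range) simp
    then show "quantize b s x \<in> (\<lambda>c. \<chi> i. s $ i * of_int (c i)) ` (UNIV \<rightarrow>\<^sub>E {- K b..K b})"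
      unfolding quantize_def
      by (intro image_eqI[where x = "\<lambda>i. clip (round (x $ i / s $ i)) (- K b) (K b)"])
        (auto simp: PiE_def extensional_def)
  qed
  show "finite ((\<lambda>c. \<chi> i. s $ i * of_int (c i)) ` ((UNIV :: 'a set) \<rightarrow>\<^sub>E {- K b..K b}))"
    by (intro finite_imageI finite_PiE) auto
qed

lemma borel_measurable_quantize: "quantize b s \<in> borel_measurable borel"
proof -
  have "(\<lambda>x. quantize b s x \<bullet> axis i 1) \<in> borel_measurable borel" for i
  proof -
    have [measurable]: "(\<lambda>x :: real ^ 'a. x $ i) \<in> borel_measurable borel"
      by (intro borel_measurable_continuous_onI continuous_intros)
    \<comment> \<open>The integer clip is turned into a real \<open>min\<close> and
      \<open>max\<close> of a floor, each a measurable operation.\<close>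
    have "(\<lambda>x. quantize b s x \<bullet> axis i 1)
        = (\<lambda>x. s $ i * min (max (of_int \<lfloor>x $ i / s $ i + 1 / 2\<rfloor>) (of_int (- K b))) (of_int (K b)))"
      by (simp add: fun_eq_iff quantize_def inner_axis clip_def round_def of_int_min of_int_max)
    also have "\<dots> \<in> borel_measurable borel"
      by measurable
    finally show ?thesis .
  qed
  then show ?thesis
    by (subst borel_measurable_euclidean_space) (auto simp: Basis_vec_def)
qed

lemma simple_function_quantize:
  assumes "x \<in> borel_measurable M"
  shows "simple_function M (\<lambda>\<omega>. quantize b s (x \<omega>))"
proof (rule simple_function_borel_measurable)
  show "(\<lambda>\<omega>. quantize b s (x \<omega>)) \<in> borel_measurable M"
    using assms borel_measurable_quantize by (rule measurable_compose)
  show "finite ((\<lambda>\<omega>. quantize b s (x \<omega>)) ` space M)"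
    by (rule finite_subset[OF _ finite_range_quantize]) auto
qed

text \<open>Finitely many values are bounded by the largest norm, and a bounded measurable function
  is integrable for a finite measure.\<close>

lemma (in finite_measure) integrable_simple_function:
  fixes h :: "'a \<Rightarrow> real"
  assumes "simple_function M h"
  shows "integrable M h"
proof -
  have "finite ((\<lambda>\<omega>. norm (h \<omega>)) ` space M)"
    using simple_functionD(1)[OF simple_function_compose1[OF assms]] .
  then have "AE \<omega> in M. norm (h \<omega>) \<le> Max ((\<lambda>\<omega>. norm (h \<omega>)) ` space M)"
    by (intro AE_I2 Max_ge) auto
  then show ?thesis
    using assms by (intro integrable_const_bound borel_measurable_simple_function)
qed

text \<open>Provides the locale in which the rules for \<open>real_cond_exp\<close> are stated. A
  finite measure stays finite on every subalgebra, hence sigma-finite there.\<close>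

lemma (in prob_space) sigma_finite_subalgebra_vimage:
  assumes "Y \<in> measurable M N"
  shows "sigma_finite_subalgebra M (vimage_algebra (space M) Y N)"
proof -
  have "subalgebra M (vimage_algebra (space M) Y N)"
    using assms by (auto simp: subalgebra_def sets_vimage_algebra2 measurable_space
        intro: measurable_sets)
  then interpret finite_measure_subalgebra M "vimage_algebra (space M) Y N"
    by unfold_locales
  show ?thesis
    by unfold_locales
qed

text \<open>The quadratic term becomes linear in \<open>J\<close> because each \<open>J $ i\<close>
  is 0 or 1 and so equals its square. A bound linear in \<open>J\<close> can be conditioned term by
  term.\<close>

lemma smooth_quantized_step:
  fixes f :: "real ^ 'd \<Rightarrow> real" and L s u y z J :: "real ^ 'd"
  assumes smooth: "f z \<le> f y + gradient f y \<bullet> (z - y)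
      + 1 / 2 * (\<Sum>i\<in>UNIV. L $ i * (z $ i - y $ i)\<^sup>2)"
    and L: "\<And>i. 0 \<le> L $ i"
    and step: "z - y = - (s * vsign u * J)"
    and J: "\<And>i. J $ i \<in> {0, 1}"
  shows "f z - f y \<le> (\<Sum>i\<in>UNIV.
      (1 / 2 * (L $ i * (s $ i)\<^sup>2) - s $ i * sgn (u $ i) * gradient f y $ i) * J $ i)"
proof -
  have d: "z $ i - y $ i = - (s $ i * sgn (u $ i) * J $ i)" for i
    using arg_cong[OF step, of "\<lambda>v. v $ i"] by (simp add: vsign_def)
  have "L $ i * (z $ i - y $ i)\<^sup>2 \<le> L $ i * (s $ i)\<^sup>2 * J $ i" for i
  proof -
    \<comment> \<open>Not an equality, since the sign is 0 where \<open>u $ i = 0\<close>. The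
      resulting one-sided bound survives multiplication by the nonnegative
      \<open>L $ i\<close>.\<close>
    have "(sgn (u $ i))\<^sup>2 \<le> 1"
      by (simp add: sgn_if)
    moreover have "(J $ i)\<^sup>2 = J $ i"
      using J[of i] by auto
    moreover have "0 \<le> J $ i"
      using J[of i] by auto
    ultimately have "(z $ i - y $ i)\<^sup>2 \<le> (s $ i)\<^sup>2 * J $ i"
      unfolding d power2_minus power_mult_distrib
      by (auto intro!: mult_right_mono mult_left_le)
    then show ?thesis
      using mult_left_mono[OF _ L[of i]] by (simp add: mult.assoc)
  qed
  then have "(\<Sum>i\<in>UNIV. L $ i * (z $ i - y $ i)\<^sup>2) \<le> (\<Sum>i\<in>UNIV. L $ i * (s $ i)\<^sup>2 * J $ i)"
    by (rule sum_mono)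
  with smooth have "f z - f y \<le> gradient f y \<bullet> (z - y) + 1 / 2 * (\<Sum>i\<in>UNIV. L $ i * (s $ i)\<^sup>2 * J $ i)"
    by linarith
  also have "\<dots> = (\<Sum>i\<in>UNIV.
      (1 / 2 * (L $ i * (s $ i)\<^sup>2) - s $ i * sgn (u $ i) * gradient f y $ i) * J $ i)"
    by (simp add: inner_vec_def d sum_distrib_left sum.distrib[symmetric] algebra_simps
        del: sum_subtractf)
  finally show ?thesis .
qed

text \<open>Conditional expectations are fixed only up to null sets, hence the almost-everywhere
  form. In the last claim the two extra assumptions are imposed at the given
  \<open>\<omega>\<close>, which covers the case where they hold for every outcome.\<close>

theorem theorem3:
  fixes f :: "real ^ 'd \<Rightarrow> real" and L s :: "real ^ 'd" and b :: nat
    and \<U> :: "real ^ 'd \<Rightarrow> real ^ 'd" and U :: real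
    and M :: "'w measure" and \<eta> :: "'w \<Rightarrow> real"
    and x q g u x' q' J :: "'w \<Rightarrow> real ^ 'd"
    and p :: "'d \<Rightarrow> real \<Rightarrow> real ^ 'd \<Rightarrow> real ^ 'd \<Rightarrow> real"
  assumes f_diff: "\<And>z. f differentiable (at z)"
    and L_nonneg: "\<And>i. 0 \<le> L $ i"
    and f_smooth: "\<And>y z. f z \<le> f y + gradient f y \<bullet> (z - y)
        + 1 / 2 * (\<Sum>i\<in>UNIV. L $ i * (z $ i - y $ i)\<^sup>2)"
    and b_pos: "1 \<le> b"
    and s_pos: "\<And>i. 0 < s $ i"
    and prob: "prob_space M"
    and x_meas: "x \<in> borel_measurable M"
    and \<eta>_meas: "\<eta> \<in> borel_measurable M"
    and q_eq: "q = (\<lambda>\<omega>. quantize b s (x \<omega>))"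
    and g_eq: "g = (\<lambda>\<omega>. gradient f (q \<omega>))"
    and u_eq: "u = (\<lambda>\<omega>. \<U> (g \<omega>))"
    and u_bound: "\<And>\<omega>. \<omega> \<in> space M \<Longrightarrow> infnorm (u \<omega>) \<le> U"
    and \<eta>_pos: "\<And>\<omega>. \<omega> \<in> space M \<Longrightarrow> 0 < \<eta> \<omega>"
    and \<eta>_bound: "\<And>\<omega> i. \<omega> \<in> space M \<Longrightarrow> \<eta> \<omega> * U < s $ i"
    and x'_eq: "x' = (\<lambda>\<omega>. x \<omega> - \<eta> \<omega> *\<^sub>R u \<omega>)"
    and q'_eq: "q' = (\<lambda>\<omega>. quantize b s (x' \<omega>))"
    and J_eq: "J = (\<lambda>\<omega>. \<chi> i. if q' \<omega> $ i \<noteq> q \<omega> $ i then 1 else 0)"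
    and p_eq: "\<And>i. AE \<omega> in M. p i (\<eta> \<omega>) (q \<omega>) (u \<omega>) =
        cond_probability M (\<lambda>\<omega>. (\<eta> \<omega>, q \<omega>, u \<omega>)) (\<lambda>\<omega>. J \<omega> $ i = 1) \<omega>"
  shows "(\<forall>\<omega>\<in>space M. q' \<omega> - q \<omega> = - (s * vsign (u \<omega>) * J \<omega>)) \<and>
    (\<forall>\<omega>\<in>space M. \<forall>i. J \<omega> $ i \<in> {0, 1}) \<and>
    (\<forall>i. AE \<omega> in M.
        cond_probability M (\<lambda>\<omega>. (\<eta> \<omega>, q \<omega>, u \<omega>)) (\<lambda>\<omega>. J \<omega> $ i = 1) \<omega>
          = p i (\<eta> \<omega>) (q \<omega>) (u \<omega>) \<and>
        cond_expectation M (\<lambda>\<omega>. (\<eta> \<omega>, q \<omega>, u \<omega>)) (\<lambda>\<omega>. J \<omega> $ i) \<omega>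
          = p i (\<eta> \<omega>) (q \<omega>) (u \<omega>)) \<and>
    (AE \<omega> in M.
        cond_expectation M (\<lambda>\<omega>. (\<eta> \<omega>, q \<omega>, u \<omega>)) (\<lambda>\<omega>. f (q' \<omega>) - f (q \<omega>)) \<omega>
          \<le> - (\<Sum>i\<in>UNIV. p i (\<eta> \<omega>) (q \<omega>) (u \<omega>) * s $ i * sgn (u \<omega> $ i) * g \<omega> $ i)
            + 1 / 2 * (\<Sum>i\<in>UNIV. p i (\<eta> \<omega>) (q \<omega>) (u \<omega>) * L $ i * (s $ i)\<^sup>2)) \<and>
    (AE \<omega> in M.
        (\<forall>i. nonsaturated b s (q \<omega>) i) \<and>
        (\<forall>i. p i (\<eta> \<omega>) (q \<omega>) (u \<omega>) = \<eta> \<omega> * \<bar>u \<omega> $ i\<bar> / s $ i) \<longrightarrow>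
        cond_expectation M (\<lambda>\<omega>. (\<eta> \<omega>, q \<omega>, u \<omega>)) (\<lambda>\<omega>. f (q' \<omega>) - f (q \<omega>)) \<omega>
          \<le> - (\<eta> \<omega> * (g \<omega> \<bullet> u \<omega>))
            + \<eta> \<omega> / 2 * (\<Sum>i\<in>UNIV. L $ i * s $ i * \<bar>u \<omega> $ i\<bar>))"
proof -
  interpret prob_space M by (rule prob)
  define Y where "Y = (\<lambda>\<omega>. (\<eta> \<omega>, q \<omega>, u \<omega>))"
  define F where "F = vimage_algebra (space M) Y borel"
  \<comment> \<open>The coefficient of \<open>J $ i\<close> in \<open>smooth_quantized_step\<close>,
    with \<open>u\<close> expressed through the gradient at \<open>y\<close>. It is thus a function
    of the endpoint alone.\<close>
  define c where "c i y = 1 / 2 * (L $ i * (s $ i)\<^sup>2)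
      - s $ i * sgn (\<U> (gradient f y) $ i) * gradient f y $ i" for i y

  have J01: "J \<omega> $ i \<in> {0, 1}" for \<omega> i
    by (simp add: J_eq)
  have step: "q' \<omega> - q \<omega> = - (s * vsign (u \<omega>) * J \<omega>)" if \<omega>: "\<omega> \<in> space M" for \<omega>
  proof (rule vec_eq_iff[THEN iffD2], rule allI)
    fix i
    have "\<bar>u \<omega> $ i\<bar> \<le> U"
      using component_le_infnorm_cart u_bound[OF \<omega>] by (rule order_trans)
    then have "\<bar>(\<eta> \<omega> *\<^sub>R u \<omega>) $ i\<bar> \<le> \<eta> \<omega> * U"
      using \<eta>_pos[OF \<omega>] by (simp add: abs_mult)
    then have "\<bar>(\<eta> \<omega> *\<^sub>R u \<omega>) $ i\<bar> < s $ i"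
      using \<eta>_bound[OF \<omega>, of i] by linarith
    \<comment> \<open>The displacement is \<open>\<eta> \<omega> *\<^sub>R u \<omega>\<close>; as
      the stepsize is positive, its signs are those of \<open>u \<omega>\<close>.\<close>
    from quantize_step[OF s_pos this, of b "x \<omega>"] show "(q' \<omega> - q \<omega>) $ i = (- (s * vsign (u \<omega>) * J \<omega>)) $ i"
      using \<eta>_pos[OF \<omega>] by (simp add: q_eq q'_eq x'_eq J_eq vsign_def sgn_mult)
  qed

  have q_simple: "simple_function M q"
    unfolding q_eq using x_meas by (rule simple_function_quantize)
  have u_meas: "u \<in> borel_measurable M"
    unfolding u_eq g_eq
    using simple_function_compose1[OF q_simple, of "\<lambda>y. \<U> (gradient f y)"]
    by (rule borel_measurable_simple_function)
  \<comment> \<open>For \<open>x'\<close> only measurability is available; quantizing it restores a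
    finite range.\<close>
  have q'_simple: "simple_function M q'"
    unfolding q'_eq x'_eq using x_meas \<eta>_meas u_meas
    by (intro simple_function_quantize borel_measurable_diff borel_measurable_scaleR)
  have Y_meas: "Y \<in> borel_measurable M"
    unfolding Y_def
    using \<eta>_meas borel_measurable_simple_function[OF q_simple] u_meas
    by (intro borel_measurable_Pair)
  interpret sigma_finite_subalgebra M F
    unfolding F_def using Y_meas by (rule sigma_finite_subalgebra_vimage)

  have J_simple: "simple_function M (\<lambda>\<omega>. J \<omega> $ i)" for i
    using simple_function_compose2[OF q_simple q'_simple,
        of "\<lambda>y z. if z $ i \<noteq> y $ i then 1 else 0 :: real"]
    by (simp add: J_eq)
  have f_simple: "simple_function M (\<lambda>\<omega>. f (q' \<omega>) - f (q \<omega>))"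
    using q_simple q'_simple by (rule simple_function_compose2[where h = "\<lambda>y z. f z - f y"])
  have cJ_simple: "simple_function M (\<lambda>\<omega>. c i (q \<omega>) * J \<omega> $ i)" for i
    using simple_function_compose1[OF q_simple] J_simple by (rule simple_function_mult)
  note integrable = J_simple[THEN integrable_simple_function]
    f_simple[THEN integrable_simple_function] cJ_simple[THEN integrable_simple_function]

  \<comment> \<open>Pulling \<open>c i (q \<omega>)\<close> out of the conditional expectation
    requires measurability with respect to \<open>F\<close>, not just \<open>M\<close>. The endpoint
    is the middle component of \<open>Y\<close>, so it is simple over \<open>F\<close>, and so is
    every function of it.\<close>
  have "Y \<in> measurable F borel"
    unfolding F_def by (rule measurable_vimage_algebra1) simp
  then have "(\<lambda>\<omega>. fst (snd (Y \<omega>))) \<in> borel_measurable F"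
    by (rule measurable_compose) (intro borel_measurable_continuous_onI continuous_intros)
  then have "simple_function F q"
    using simple_functionD(1)[OF q_simple]
    by (intro simple_function_borel_measurable) (simp_all add: Y_def F_def)
  then have c_meas: "(\<lambda>\<omega>. c i (q \<omega>)) \<in> borel_measurable F" for i
    by (rule borel_measurable_simple_function[OF simple_function_compose1])

  \<comment> \<open>The hypothesis \<open>p_eq\<close> concerns the event
    \<open>J \<omega> $ i = 1\<close>; being 0 or 1, the variable \<open>J \<omega> $ i\<close>
    coincides on the space with the indicator of that event.\<close>
  have pJ: "AE \<omega> in M. real_cond_exp M F (\<lambda>\<omega>. J \<omega> $ i) \<omega> = p i (\<eta> \<omega>) (q \<omega>) (u \<omega>)" for i
  proof -
    have J_meas: "(\<lambda>\<omega>. J \<omega> $ i) \<in> borel_measurable M"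
      using J_simple by (rule borel_measurable_simple_function)
    have "{\<omega> \<in> space M. J \<omega> $ i = 1} \<in> sets M"
      using J_meas by measurable
    moreover have "AE \<omega> in M. J \<omega> $ i = indicator {\<omega> \<in> space M. J \<omega> $ i = 1} \<omega>"
      using J01 by (intro AE_I2) (auto simp: indicator_def)
    ultimately have "AE \<omega> in M. real_cond_exp M F (\<lambda>\<omega>. J \<omega> $ i) \<omega>
        = real_cond_exp M F (indicator {\<omega> \<in> space M. J \<omega> $ i = 1}) \<omega>"
      using J_meas by (intro real_cond_exp_cong) auto
    with p_eq[of i] show ?thesis
      unfolding cond_probability_def cond_expectation_def F_def Y_def by eventually_elim simp
  qed

  have "AE \<omega> in M. f (q' \<omega>) - f (q \<omega>) \<le> (\<Sum>i\<in>UNIV. c i (q \<omega>) * J \<omega> $ i)"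
    using smooth_quantized_step[OF f_smooth L_nonneg step J01]
    by (intro AE_I2) (simp add: c_def u_eq g_eq)
  then have mono: "AE \<omega> in M. real_cond_exp M F (\<lambda>\<omega>. f (q' \<omega>) - f (q \<omega>)) \<omega>
      \<le> real_cond_exp M F (\<lambda>\<omega>. \<Sum>i\<in>UNIV. c i (q \<omega>) * J \<omega> $ i) \<omega>"
    using integrable by (intro real_cond_exp_mono) auto
  \<comment> \<open>Linearity suffices here, whatever the dependence between the crossings of
    different coordinates.\<close>
  have sum: "AE \<omega> in M. real_cond_exp M F (\<lambda>\<omega>. \<Sum>i\<in>UNIV. c i (q \<omega>) * J \<omega> $ i) \<omega>
      = (\<Sum>i\<in>UNIV. real_cond_exp M F (\<lambda>\<omega>. c i (q \<omega>) * J \<omega> $ i) \<omega>)"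
    using integrable(3) by (rule real_cond_exp_sum)
  have "AE \<omega> in M. real_cond_exp M F (\<lambda>\<omega>. c i (q \<omega>) * J \<omega> $ i) \<omega>
      = c i (q \<omega>) * real_cond_exp M F (\<lambda>\<omega>. J \<omega> $ i) \<omega>" for i
    using c_meas integrable(1,3) by (intro real_cond_exp_mult) auto
  \<comment> \<open>There are finitely many coordinates, so the exceptional null sets combine into
    one.\<close>
  then have pull_out: "AE \<omega> in M. \<forall>i\<in>UNIV. real_cond_exp M F (\<lambda>\<omega>. c i (q \<omega>) * J \<omega> $ i) \<omega>
      = c i (q \<omega>) * real_cond_exp M F (\<lambda>\<omega>. J \<omega> $ i) \<omega>"
    by (intro AE_finite_allI) auto
  have pJ': "AE \<omega> in M. \<forall>i\<in>UNIV. real_cond_exp M F (\<lambda>\<omega>. J \<omega> $ i) \<omega> = p i (\<eta> \<omega>) (q \<omega>) (u \<omega>)"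
    using pJ by (intro AE_finite_allI) auto
  have descent: "AE \<omega> in M. real_cond_exp M F (\<lambda>\<omega>. f (q' \<omega>) - f (q \<omega>)) \<omega>
      \<le> - (\<Sum>i\<in>UNIV. p i (\<eta> \<omega>) (q \<omega>) (u \<omega>) * s $ i * sgn (u \<omega> $ i) * g \<omega> $ i)
        + 1 / 2 * (\<Sum>i\<in>UNIV. p i (\<eta> \<omega>) (q \<omega>) (u \<omega>) * L $ i * (s $ i)\<^sup>2)"
    using mono sum pull_out pJ'
  proof eventually_elim
    case (elim \<omega>)
    then have "real_cond_exp M F (\<lambda>\<omega>. f (q' \<omega>) - f (q \<omega>)) \<omega>
        \<le> (\<Sum>i\<in>UNIV. c i (q \<omega>) * p i (\<eta> \<omega>) (q \<omega>) (u \<omega>))"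
      by simp
    also have "\<dots> = - (\<Sum>i\<in>UNIV. p i (\<eta> \<omega>) (q \<omega>) (u \<omega>) * s $ i * sgn (u \<omega> $ i) * g \<omega> $ i)
        + 1 / 2 * (\<Sum>i\<in>UNIV. p i (\<eta> \<omega>) (q \<omega>) (u \<omega>) * L $ i * (s $ i)\<^sup>2)"
      by (simp add: c_def u_eq g_eq sum_distrib_left sum_negf[symmetric] sum.distrib[symmetric]
          algebra_simps del: sum_negf sum_subtractf)
    finally show ?case .
  qed

  \<comment> \<open>With this crossing probability, \<open>p\<close> times
    \<open>s $ i * sgn (u \<omega> $ i)\<close> is \<open>\<eta> \<omega> * u \<omega> $ i\<close>:
    the expected displacement is that of the unquantized step. One factor \<open>s $ i\<close> of
    the square also cancels in the curvature term.\<close>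
  have unbiased: "- (\<Sum>i\<in>UNIV. p i (\<eta> \<omega>) (q \<omega>) (u \<omega>) * s $ i * sgn (u \<omega> $ i) * g \<omega> $ i)
        + 1 / 2 * (\<Sum>i\<in>UNIV. p i (\<eta> \<omega>) (q \<omega>) (u \<omega>) * L $ i * (s $ i)\<^sup>2)
      = - (\<eta> \<omega> * (g \<omega> \<bullet> u \<omega>)) + \<eta> \<omega> / 2 * (\<Sum>i\<in>UNIV. L $ i * s $ i * \<bar>u \<omega> $ i\<bar>)"
    if p: "\<forall>i. p i (\<eta> \<omega>) (q \<omega>) (u \<omega>) = \<eta> \<omega> * \<bar>u \<omega> $ i\<bar> / s $ i" for \<omega>
  proof -
    have s: "s $ i \<noteq> 0" for i
      using s_pos[of i] by simp
    have "p i (\<eta> \<omega>) (q \<omega>) (u \<omega>) * s $ i * sgn (u \<omega> $ i) * g \<omega> $ i = \<eta> \<omega> * (g \<omega> $ i * u \<omega> $ i)" for i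
      using p s[of i] by (simp add: abs_sgn sgn_if)
    moreover have "p i (\<eta> \<omega>) (q \<omega>) (u \<omega>) * L $ i * (s $ i)\<^sup>2 = \<eta> \<omega> * (L $ i * s $ i * \<bar>u \<omega> $ i\<bar>)" for i
      using p s[of i] by (simp add: power2_eq_square)
    ultimately show ?thesis
      by (simp only: inner_vec_def inner_real_def sum_distrib_left) (simp add: sum_distrib_left)
  qed

  have cond_p: "AE \<omega> in M.
      cond_probability M (\<lambda>\<omega>. (\<eta> \<omega>, q \<omega>, u \<omega>)) (\<lambda>\<omega>. J \<omega> $ i = 1) \<omega> = p i (\<eta> \<omega>) (q \<omega>) (u \<omega>) \<and>
      cond_expectation M (\<lambda>\<omega>. (\<eta> \<omega>, q \<omega>, u \<omega>)) (\<lambda>\<omega>. J \<omega> $ i) \<omega> = p i (\<eta> \<omega>) (q \<omega>) (u \<omega>)" for i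
    using p_eq[of i] pJ[of i]
    by eventually_elim (simp add: cond_expectation_def F_def Y_def)
  note descent' = descent[unfolded F_def Y_def, folded cond_expectation_def]
  \<comment> \<open>The identity \<open>unbiased\<close> holds pointwise, so the exceptional null
    set is the one from \<open>descent'\<close>.\<close>
  from descent' have "AE \<omega> in M.
      (\<forall>i. nonsaturated b s (q \<omega>) i) \<and>
      (\<forall>i. p i (\<eta> \<omega>) (q \<omega>) (u \<omega>) = \<eta> \<omega> * \<bar>u \<omega> $ i\<bar> / s $ i) \<longrightarrow>
      cond_expectation M (\<lambda>\<omega>. (\<eta> \<omega>, q \<omega>, u \<omega>)) (\<lambda>\<omega>. f (q' \<omega>) - f (q \<omega>)) \<omega>
        \<le> - (\<eta> \<omega> * (g \<omega> \<bullet> u \<omega>)) + \<eta> \<omega> / 2 * (\<Sum>i\<in>UNIV. L $ i * s $ i * \<bar>u \<omega> $ i\<bar>)"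
  proof eventually_elim
    case (elim \<omega>)
    then show ?case
      using ord_le_eq_trans[OF _ unbiased] by blast
  qed
  with step J01 cond_p descent' show ?thesis
    by (intro conjI ballI allI)
qed

end
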